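(* Let $n$ and $m$ be nonnegative integers with $m\le n$. If $m>0$, then $$T_{n,m}(q) = \sum_{r=1}^{\lfloor (n+m)/2\rfloor} (-1)^{r-1} q^{r(r-2m+1)} \begin{bmatrix} n-r+m\\ r\end{bmatrix}_q T_{n-r,m}(q)\, \frac{(-q^{n-r+1};q)_r}{(-q;q)_r}.$$ When $m=0$, the identity is $$\begin{bmatrix} 2n\\ n\end{bmatrix}_q = \sum_{r=1}^{\lfloor n/2\rfloor} (-1)^{r-1} q^{r(r+1)} \begin{bmatrix} n-r\\ r\end{bmatrix}_q \begin{bmatrix} 2n-2r\\ n-r\end{bmatrix}_q \frac{(-q^{n-r+1};q)_r}{(-q;q)_r} + (-q;q)_n.$$
   Context: $q$ is an indeterminate; identities are in the field of rational functions in $q$. $(a;q)_0=1$ and $(a;q)_n=\prod_{k=0}^{n-1}(1-aq^k)$ for $n\ge 1$. $[i]_q=\frac{1-q^i}{1-q}$, $[k]_q!=\prod_{i=1}^k [i]_q$, and $\begin{bmatrix} n\\k\end{bmatrix}_q=\frac{[n]_q!}{[k]_q![n-k]_q!}$ for $0\le k\le n$. The $q$-super Catalan numbers are, for nonnegative integers $n,m$, $T_{n,m}(q)=\frac{[2m]_q!\,[2n]_q!}{[m]_q!\,[n]_q!\,[m+n]_q!}$. *)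

theory Defs
  imports
    "HOL-Computational_Algebra.Polynomial"
    "HOL-Computational_Algebra.Fraction_Field"
begin

(* The indeterminate q of the field Q(q), represented as the fraction field of Q[q]. *)
definition q_indet :: "rat poly fract" where
  "q_indet = Fract [:0, 1:] 1"

definition q_pochhammer :: "'a::field \<Rightarrow> 'a \<Rightarrow> nat \<Rightarrow> 'a" where
  "q_pochhammer a q n = (\<Prod>k<n. 1 - a * q ^ k)"

(* As usual in a field, x / 0 = 0, so this is the intended q-integer only for q \<noteq> 1. *)
definition q_int :: "'a::field \<Rightarrow> nat \<Rightarrow> 'a" where
  "q_int q i = (1 - q ^ i) / (1 - q)"

definition q_factorial :: "'a::field \<Rightarrow> nat \<Rightarrow> 'a" where
  "q_factorial q k = (\<Prod>i=1..k. q_int q i)"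

definition q_binomial :: "'a::field \<Rightarrow> nat \<Rightarrow> nat \<Rightarrow> 'a" where
  "q_binomial q n k =
     (if k \<le> n then q_factorial q n / (q_factorial q k * q_factorial q (n - k)) else 0)"

definition q_super_catalan :: "'a::field \<Rightarrow> nat \<Rightarrow> nat \<Rightarrow> 'a" where
  "q_super_catalan q n m =
     (q_factorial q (2 * m) * q_factorial q (2 * n)) /
     (q_factorial q m * q_factorial q n * q_factorial q (m + n))"

end

theory Submission
  imports Defs
begin

text \<open>
  Cancelling the q-factorials of \<open>n+m-r\<close> and a common factor, and writing \<open>(q;q)\<^sub>2\<^sub>n = (q;q\<^sup>2)\<^sub>n (q;q)\<^sub>n (-q;q)\<^sub>n\<close>, the
  identity, with its left-hand side as the summand for \<open>r = 0\<close>, says that the sum over \<open>r\<close> of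
  \<open>(-1)\<^sup>r q\<^bsup>r(r+1-2m)\<^esup> (q;q\<^sup>2)\<^bsub>n-r\<^esub> / ((q\<^sup>2;q\<^sup>2)\<^sub>r (q;q)\<^bsub>n+m-2r\<^esub>)\<close> is \<open>1\<close> for \<open>m = 0\<close> and
  \<open>0\<close> otherwise. Put \<open>p = q\<^sup>2\<close>, \<open>k = \<lfloor>(n+m)/2\<rfloor>\<close> and \<open>j = k - m\<close>. Splitting
  \<open>(q;q)\<^bsub>n+m-2r\<^esub>\<close> into its odd and even factors, the odd ones divide \<open>(q;q\<^sup>2)\<^bsub>n-r\<^esub>\<close> and leave
  a polynomial of degree \<open>j\<close> in \<open>p\<^bsup>-r\<^esup>\<close> with constant term \<open>1\<close>. By the finite q-binomial
  theorem the monomial of degree \<open>i\<close> contributes \<open>(p\<^bsup>1-m-i\<^esup>;p)\<^sub>k / (p;p)\<^sub>k\<close>, which vanishes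
  unless \<open>m = i = 0\<close>, because \<open>m + i \<le> k\<close>.
\<close>

section \<open>q-Pochhammer symbols: nonvanishing and factorizations\<close>

lemma q_pochhammer_0 [simp]: "q_pochhammer a q 0 = 1"
  by (simp add: q_pochhammer_def)

lemma q_pochhammer_Suc: "q_pochhammer a q (Suc n) = q_pochhammer a q n * (1 - a * q ^ n)"
  by (simp add: q_pochhammer_def)

lemma q_pochhammer_add:
  "q_pochhammer a q (n + k) = q_pochhammer a q n * q_pochhammer (a * q ^ n) q k"
  by (induction k) (simp_all add: q_pochhammer_Suc power_add mult_ac)

lemma q_pochhammer_self_neq_0:
  fixes q :: "'a::field"
  assumes "\<forall>i>0. q ^ i \<noteq> 1"
  shows "q_pochhammer q q n \<noteq> 0"
  using assms by (auto simp: q_pochhammer_def simp flip: power_Suc)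

text \<open>A vanishing factor would make a positive power of \<open>q\<close> equal to -1, and its
  square would be a positive power equal to 1.\<close>

lemma q_pochhammer_minus_neq_0:
  fixes q :: "'a::field"
  assumes "\<forall>i>0. q ^ i \<noteq> 1"
  shows "q_pochhammer (- q) q n \<noteq> 0"
proof -
  have "1 + q ^ Suc i \<noteq> 0" for i
  proof
    assume "1 + q ^ Suc i = 0"
    then have "q ^ Suc i = - 1"
      by (simp add: eq_neg_iff_add_eq_0 add.commute)
    then have "(q ^ Suc i) ^ 2 = 1"
      by simp
    then have "q ^ (Suc i * 2) = 1"
      by (simp only: power_mult)
    moreover have "Suc i * 2 > 0"
      by simp
    ultimately show False
      using assms by blast
  qed
  then show ?thesis by (simp add: q_pochhammer_def)
qed

lemma q_pochhammer_even:
  "q_pochhammer q q (2 * n) = q_pochhammer q (q ^ 2) n * q_pochhammer (q ^ 2) (q ^ 2) n"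
proof (induction n)
  case (Suc n)
  have "q_pochhammer q q (2 * Suc n) =
      q_pochhammer q q (2 * n) * (1 - q * q ^ (2 * n)) * (1 - q * q ^ Suc (2 * n))"
    by (simp add: q_pochhammer_Suc)
  moreover have "q ^ (2 * n) = (q ^ 2) ^ n" "q * q ^ Suc (2 * n) = q ^ 2 * (q ^ 2) ^ n"
    by (simp_all add: power_mult power2_eq_square)
  ultimately show ?case
    by (simp only: Suc.IH q_pochhammer_Suc) (simp only: mult_ac)
qed simp

lemma q_pochhammer_odd:
  "q_pochhammer q q (2 * n + 1) =
     q_pochhammer q (q ^ 2) (n + 1) * q_pochhammer (q ^ 2) (q ^ 2) n"
  by (simp add: q_pochhammer_even q_pochhammer_Suc flip: power_mult)

lemma q_pochhammer_square:
  "q_pochhammer (q ^ 2) (q ^ 2) n = q_pochhammer q q n * q_pochhammer (- q) q n"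
proof (induction n)
  case (Suc n)
  have "1 - q ^ 2 * (q ^ 2) ^ n = (1 - q * q ^ n) * (1 + q * q ^ n)"
    by (simp add: algebra_simps power2_eq_square power_mult_distrib)
  with Suc show ?case
    by (simp add: q_pochhammer_Suc mult_ac)
qed simp

section \<open>Translation of q-factorial quotients into q-Pochhammer symbols\<close>

lemma q_factorial_eq:
  "q_factorial q n = q_pochhammer q q n / (1 - q) ^ n"
  by (induction n) (simp_all add: q_factorial_def q_pochhammer_Suc q_int_def)

lemma q_binomial_eq:
  fixes q :: "'a::field"
  assumes "q \<noteq> 1" "k \<le> n"
  shows "q_binomial q n k =
    q_pochhammer q q n / (q_pochhammer q q k * q_pochhammer q q (n - k))"
proof -
  have "(1 - q) ^ n = (1 - q) ^ k * (1 - q) ^ (n - k)"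
    using assms by (simp flip: power_add)
  with assms show ?thesis
    by (simp add: q_binomial_def q_factorial_eq)
qed

text \<open>The powers of \<open>1 - q\<close> cancel. The quotient depending only on
  \<open>m\<close> is kept apart, since it is constant in the summation over
  \<open>r\<close>.\<close>

lemma q_super_catalan_eq:
  fixes q :: "'a::field"
  assumes "\<forall>i>0. q ^ i \<noteq> 1"
  shows "q_super_catalan q n m =
    q_pochhammer q q (2 * m) / q_pochhammer q q m *
    (q_pochhammer q (q ^ 2) n * q_pochhammer (- q) q n / q_pochhammer q q (m + n))"
proof -
  have "q \<noteq> 1" using assms by (metis power_one_right zero_less_one)
  moreover have "(1 - q) ^ (2 * m) * (1 - q) ^ (2 * n) =
      (1 - q) ^ m * (1 - q) ^ n * (1 - q) ^ (m + n)"
    by (simp add: mult_2 power_add)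
  ultimately have "q_super_catalan q n m =
      q_pochhammer q q (2 * m) * q_pochhammer q q (2 * n) /
      (q_pochhammer q q m * q_pochhammer q q n * q_pochhammer q q (m + n))"
    by (simp add: q_super_catalan_def q_factorial_eq)
  then show ?thesis
    using q_pochhammer_self_neq_0[OF assms]
    by (simp add: q_pochhammer_even[of q n] q_pochhammer_square)
qed

lemma q_super_catalan_0_right:
  "q_super_catalan q n 0 = q_binomial q (2 * n) n"
  by (simp add: q_super_catalan_def q_binomial_def q_factorial_def)

section \<open>The finite q-binomial theorem and sums that vanish by it\<close>

text \<open>Induction after multiplying by \<open>1 - p ^ Suc k\<close>, which is split so that one
  part cancels the last factor of \<open>?P (Suc k - r)\<close> and the other that of
  \<open>?P r\<close>. Each part then yields a multiple of the sum for \<open>k\<close>.\<close>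

lemma finite_q_binomial_theorem:
  fixes p z :: "'a::field"
  assumes p: "\<forall>i>0. p ^ i \<noteq> 1"
  shows "(\<Sum>r\<le>k. (- 1) ^ r * p ^ (r choose 2) * z ^ r /
      (q_pochhammer p p r * q_pochhammer p p (k - r))) = q_pochhammer z p k / q_pochhammer p p k"
proof (induction k)
  case (Suc k)
  let ?P = "q_pochhammer p p"
  let ?u = "\<lambda>k r. (- 1) ^ r * p ^ (r choose 2) * z ^ r / (?P r * ?P (k - r))"
  have nz: "?P i \<noteq> 0" "1 - p * p ^ i \<noteq> 0" for i
    using q_pochhammer_self_neq_0[OF p] p by (auto simp flip: power_Suc)
  have low: "?u (Suc k) r * (1 - p ^ (Suc k - r)) = ?u k r" if "r \<le> k" for r
    using that nz by (simp add: Suc_diff_le q_pochhammer_Suc)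
  have high: "?u (Suc k) (Suc r) * (p ^ (k - r) * (1 - p ^ Suc r)) = - z * p ^ k * ?u k r"
    if "r \<le> k" for r
  proof -
    have "p ^ k = p ^ (k - r) * p ^ r"
      using that by (simp flip: power_add)
    moreover have "Suc r choose 2 = r + (r choose 2)"
      by (simp add: numeral_2_eq_2)
    ultimately show ?thesis
      using nz by (simp add: q_pochhammer_Suc power_add)
  qed
  have split: "1 - p ^ Suc k = (1 - p ^ (Suc k - r)) + p ^ (Suc k - r) * (1 - p ^ r)"
    if "r \<le> Suc k" for r
  proof -
    have "p ^ Suc k = p ^ (Suc k - r) * p ^ r"
      using that by (simp flip: power_add)
    then show ?thesis by (simp add: algebra_simps)
  qed
  have factor: "x + - z * p ^ k * x = (1 - z * p ^ k) * x" for x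
    by (simp add: algebra_simps)
  have "(\<Sum>r\<le>Suc k. ?u (Suc k) r) * (1 - p ^ Suc k) =
      (\<Sum>r\<le>Suc k. ?u (Suc k) r * (1 - p ^ (Suc k - r)) +
                   ?u (Suc k) r * (p ^ (Suc k - r) * (1 - p ^ r)))"
    unfolding sum_distrib_right
  proof (rule sum.cong[OF refl])
    fix r assume "r \<in> {..Suc k}"
    then have "r \<le> Suc k" by simp
    from split[OF this]
    show "?u (Suc k) r * (1 - p ^ Suc k) = ?u (Suc k) r * (1 - p ^ (Suc k - r)) +
          ?u (Suc k) r * (p ^ (Suc k - r) * (1 - p ^ r))"
      by (simp only: distrib_left)
  qed
  also have "\<dots> = (\<Sum>r\<le>Suc k. ?u (Suc k) r * (1 - p ^ (Suc k - r))) +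
      (\<Sum>r\<le>Suc k. ?u (Suc k) r * (p ^ (Suc k - r) * (1 - p ^ r)))"
    by (rule sum.distrib)
  \<comment> \<open>The term \<open>r = Suc k\<close> vanishes here; in the other sum
    \<open>r = 0\<close> vanishes, which allows an index shift.\<close>
  also have "(\<Sum>r\<le>Suc k. ?u (Suc k) r * (1 - p ^ (Suc k - r))) = (\<Sum>r\<le>k. ?u k r)"
    unfolding sum.atMost_Suc using low by simp
  also have "(\<Sum>r\<le>Suc k. ?u (Suc k) r * (p ^ (Suc k - r) * (1 - p ^ r))) =
      (\<Sum>r\<le>k. - z * p ^ k * ?u k r)"
    unfolding sum.atMost_Suc_shift using high by simp
  also have "\<dots> = - z * p ^ k * (\<Sum>r\<le>k. ?u k r)"
    by (rule sum_distrib_left[symmetric])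
  finally have "(\<Sum>r\<le>Suc k. ?u (Suc k) r) * (1 - p ^ Suc k) =
      (1 - z * p ^ k) * (q_pochhammer z p k / ?P k)"
    by (simp only: Suc.IH factor)
  then have "(\<Sum>r\<le>Suc k. ?u (Suc k) r) =
      (1 - z * p ^ k) * (q_pochhammer z p k / ?P k) / (1 - p ^ Suc k)"
    by (rule eq_divide_imp[rotated]) (use nz in simp)
  then show ?case
    by (simp only: q_pochhammer_Suc) (simp add: mult_ac)
qed (simp add: numeral_2_eq_2)

lemma q_pochhammer_power_inverse_eq_0:
  fixes p :: "'a::field"
  assumes "p \<noteq> 0" "i < k"
  shows "q_pochhammer (inverse p ^ i) p k = 0"
proof -
  have "1 - inverse p ^ i * p ^ i = 0"
    using assms by (simp flip: power_mult_distrib)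
  with assms show ?thesis by (auto simp: q_pochhammer_def)
qed

text \<open>Multiplying by one more factor of the polynomial subtracts the same sum for \<open>m + 1\<close>.\<close>

lemma q_binomial_sum_polynomial:
  fixes p c :: "'a::field"
  assumes p: "p \<noteq> 0" "\<forall>i>0. p ^ i \<noteq> 1" and "m + j \<le> k"
  shows "(\<Sum>r\<le>k. (- 1) ^ r * p ^ (r choose 2) * (p * inverse p ^ m) ^ r /
      (q_pochhammer p p r * q_pochhammer p p (k - r)) *
      q_pochhammer (c * inverse p ^ r) p j) = of_bool (m = 0)"
  using \<open>m + j \<le> k\<close>
proof (induction j arbitrary: m)
  case 0
  \<comment> \<open>The argument is \<open>p\<close> for \<open>m = 0\<close>, where numerator and
    denominator agree, and otherwise a power of \<open>inverse p\<close> with exponent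
    \<open>m - 1 < k\<close>.\<close>
  have "q_pochhammer (p * inverse p ^ m) p k / q_pochhammer p p k = of_bool (m = 0)"
  proof (cases m)
    case 0
    then show ?thesis using q_pochhammer_self_neq_0[OF p(2)] by simp
  next
    case (Suc i)
    then have "p * inverse p ^ m = inverse p ^ i" using p by simp
    moreover have "q_pochhammer (inverse p ^ i) p k = 0"
      using Suc 0 p by (intro q_pochhammer_power_inverse_eq_0) simp_all
    ultimately show ?thesis using Suc by (simp only:) simp
  qed
  then show ?case
    by (simp add: finite_q_binomial_theorem[OF p(2)])
next
  case (Suc j)
  let ?u = "\<lambda>m r. (- 1) ^ r * p ^ (r choose 2) * (p * inverse p ^ m) ^ r /
      (q_pochhammer p p r * q_pochhammer p p (k - r))"
  let ?Q = "\<lambda>j r. q_pochhammer (c * inverse p ^ r) p j"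
  have "?u m r * ?Q (Suc j) r = ?u m r * ?Q j r - c * p ^ j * (?u (Suc m) r * ?Q j r)" for r
  proof -
    have "(p * inverse p ^ Suc m) ^ r = (p * inverse p ^ m) ^ r * inverse p ^ r"
      by (simp add: power_mult_distrib mult_ac)
    then have u_Suc: "?u (Suc m) r = ?u m r * inverse p ^ r"
      by simp
    have "x * (y * (1 - c * z * p ^ j)) = x * y - c * p ^ j * (x * z * y)" for x y z
      by (simp add: algebra_simps)
    then show ?thesis
      by (simp only: q_pochhammer_Suc u_Suc)
  qed
  then have "(\<Sum>r\<le>k. ?u m r * ?Q (Suc j) r) =
      (\<Sum>r\<le>k. ?u m r * ?Q j r) - c * p ^ j * (\<Sum>r\<le>k. ?u (Suc m) r * ?Q j r)"
    by (simp only: sum_subtractf sum_distrib_left)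
  \<comment> \<open>The second sum is 0 because \<open>Suc m\<close> is positive; its hypothesis
    \<open>Suc m + j \<le> k\<close> is the current premise.\<close>
  also have "\<dots> = of_bool (m = 0)"
    using Suc.IH[of m] Suc.IH[of "Suc m"] Suc.prems by simp
  finally show ?case .
qed

section \<open>The alternating sum and the recurrence\<close>

lemma alternating_q_pochhammer_sum:
  fixes q :: "'a::field"
  assumes q: "q \<noteq> 0" "\<forall>i>0. q ^ i \<noteq> 1" and "m \<le> n"
  shows "(\<Sum>r\<le>(n + m) div 2. (- 1) ^ r * q powi (int r * (int r - 2 * int m + 1)) *
      q_pochhammer q (q ^ 2) (n - r) /
      (q_pochhammer q q r * q_pochhammer (- q) q r * q_pochhammer q q (n + m - 2 * r))) =
    of_bool (m = 0)"
proof -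
  define p where "p = q ^ 2"
  \<comment> \<open>Among the exponents \<open>1, ..., n + m\<close>, \<open>k\<close> are even and
    \<open>s\<close> are odd; \<open>j\<close> is also \<open>n - s\<close>.\<close>
  define k where "k = (n + m) div 2"
  define s where "s = n + m - k"
  define j where "j = k - m"
  have sizes: "n = s + j" "k = m + j" "k \<le> s" "s = k \<or> s = k + 1" "n + m = s + k"
    using \<open>m \<le> n\<close> unfolding s_def j_def k_def by presburger+
  have p: "p \<noteq> 0" "\<forall>i>0. p ^ i \<noteq> 1"
    using q by (auto simp: p_def simp flip: power_mult)
  have "(- 1) ^ r * q powi (int r * (int r - 2 * int m + 1)) * q_pochhammer q p (n - r) /
      (q_pochhammer q q r * q_pochhammer (- q) q r * q_pochhammer q q (n + m - 2 * r)) =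
    (- 1) ^ r * p ^ (r choose 2) * (p * inverse p ^ m) ^ r /
      (q_pochhammer p p r * q_pochhammer p p (k - r)) *
      q_pochhammer (q ^ (2 * s + 1) * inverse p ^ r) p j" if "r \<le> k" for r
  proof -
    have odd_even: "q_pochhammer q q (n + m - 2 * r) = q_pochhammer q p (s - r) * q_pochhammer p p (k - r)"
    proof (cases "s = k")
      case True
      then have "n + m - 2 * r = 2 * (k - r)" using sizes by simp
      then show ?thesis using True by (simp only: q_pochhammer_even p_def)
    next
      case False
      then have "s = k + 1" using sizes by simp
      then have "n + m - 2 * r = 2 * (k - r) + 1" "s - r = k - r + 1"
        using sizes that by simp_all
      then show ?thesis by (simp only: q_pochhammer_odd p_def)
    qed
    have "q_pochhammer q p (s - r) \<noteq> 0"
      using q_pochhammer_self_neq_0[OF q(2), of "2 * (s - r)"]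
      by (auto simp: q_pochhammer_even p_def)
    moreover have "q_pochhammer q p (n - r) =
        q_pochhammer q p (s - r) * q_pochhammer (q ^ (2 * s + 1) * inverse p ^ r) p j"
    proof -
      \<comment> \<open>The factors left over start at \<open>q * p ^ (s - r)\<close>. Rewriting
        this isolates \<open>q ^ (2 * s + 1)\<close>, which is free of \<open>r\<close> and serves
        as \<open>c\<close>.\<close>
      have "p ^ s = p ^ (s - r) * p ^ r"
        using that sizes by (simp flip: power_add)
      then have "q * p ^ (s - r) = q * p ^ s * inverse p ^ r"
        using p by (simp add: power_inverse)
      then have "q * p ^ (s - r) = q ^ (2 * s + 1) * inverse p ^ r"
        by (simp add: p_def power_mult)
      moreover have "n - r = (s - r) + j" using that sizes by simp
      ultimately show ?thesis by (simp only: q_pochhammer_add)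
    qed
    moreover have "q powi (int r * (int r - 2 * int m + 1)) =
        p ^ (r choose 2) * (p * inverse p ^ m) ^ r"
    proof -
      have "2 * (r choose 2) = r * (r - 1)"
        unfolding choose_two by (rule dvd_mult_div_cancel) (cases r; simp)
      \<comment> \<open>The case \<open>r = 0\<close> is separate because \<open>r - 1\<close>
        truncates on naturals.\<close>
      then have "2 * int (r choose 2) = int r * (int r - 1)"
        by (cases r) (simp_all flip: of_nat_mult of_nat_add add: algebra_simps)
      then have "int r * (int r - 2 * int m + 1) =
          int (2 * (r choose 2)) + int (2 * r) - int (2 * (m * r))"
        by (simp add: algebra_simps)
      then have "q powi (int r * (int r - 2 * int m + 1)) =
          q ^ (2 * (r choose 2)) * q ^ (2 * r) / q ^ (2 * (m * r))"
        using q(1) by (simp only: power_int_diff power_int_add power_int_of_nat simp_thms)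
      also have "\<dots> = p ^ (r choose 2) * (p * inverse p ^ m) ^ r"
        by (simp add: p_def power_mult power_mult_distrib power_inverse divide_inverse)
      finally show ?thesis .
    qed
    moreover have "q_pochhammer q q r * q_pochhammer (- q) q r = q_pochhammer p p r"
      by (simp add: p_def q_pochhammer_square)
    ultimately show ?thesis by (simp add: odd_even)
  qed
  then have "(\<Sum>r\<le>k. (- 1) ^ r * q powi (int r * (int r - 2 * int m + 1)) *
      q_pochhammer q p (n - r) /
      (q_pochhammer q q r * q_pochhammer (- q) q r * q_pochhammer q q (n + m - 2 * r))) =
    (\<Sum>r\<le>k. (- 1) ^ r * p ^ (r choose 2) * (p * inverse p ^ m) ^ r /
      (q_pochhammer p p r * q_pochhammer p p (k - r)) *
      q_pochhammer (q ^ (2 * s + 1) * inverse p ^ r) p j)"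
    by (intro sum.cong) auto
  also have "\<dots> = of_bool (m = 0)"
    by (rule q_binomial_sum_polynomial[OF p]) (simp add: sizes)
  finally show ?thesis
    by (simp only: p_def k_def)
qed

lemma q_super_catalan_recurrence:
  fixes q :: "'a::field"
  assumes q: "q \<noteq> 0" "\<forall>i>0. q ^ i \<noteq> 1" and "m \<le> n"
  shows "q_super_catalan q n m =
    (\<Sum>r = 1..(n + m) div 2.
      (- 1) ^ (r - 1) * q powi (int r * (int r - 2 * int m + 1)) *
      q_binomial q (n - r + m) r * q_super_catalan q (n - r) m *
      (q_pochhammer (- (q ^ (n - r + 1))) q r / q_pochhammer (- q) q r)) +
    of_bool (m = 0) * q_pochhammer (- q) q n"
proof -
  let ?F = "q_pochhammer q q" and ?B = "q_pochhammer (- q) q" and ?A = "q_pochhammer q (q ^ 2)"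
  let ?k = "(n + m) div 2"
  \<comment> \<open>The common factor of all terms: \<open>?B n\<close> absorbs both
    \<open>?B (n - r)\<close> and the numerator of the last quotient.\<close>
  define K where "K = ?F (2 * m) / ?F m * ?B n"
  let ?e = "\<lambda>r. q powi (int r * (int r - 2 * int m + 1))"
  let ?t = "\<lambda>r. (- 1) ^ r * ?e r * ?A (n - r) / (?F r * ?B r * ?F (n + m - 2 * r))"
  have nz: "?F i \<noteq> 0" "?B i \<noteq> 0" for i
    using q_pochhammer_self_neq_0[OF q(2)] q_pochhammer_minus_neq_0[OF q(2)] by auto
  have q1: "q \<noteq> 1" using q(2) by (metis power_one_right zero_less_one)
  have summand: "(- 1) ^ (r - 1) * ?e r *
      q_binomial q (n - r + m) r * q_super_catalan q (n - r) m *
      (q_pochhammer (- (q ^ (n - r + 1))) q r / ?B r) = - (K * ?t r)"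
    if "r \<in> {1..?k}" for r
  proof -
    \<comment> \<open>No natural subtraction truncates, and \<open>q_binomial\<close> is outside its
      default case.\<close>
    have r: "r \<ge> 1" "r \<le> n" "r \<le> n - r + m" "n - r + m - r = n + m - 2 * r"
      using that \<open>m \<le> n\<close> by auto
    have "?B n = ?B (n - r) * q_pochhammer (- (q ^ (n - r + 1))) q r"
      using q_pochhammer_add[of "- q" q "n - r" r] r by simp
    then have "K = ?F (2 * m) / ?F m * (?B (n - r) * q_pochhammer (- (q ^ (n - r + 1))) q r)"
      by (simp add: K_def)
    moreover have "(- 1 :: 'a) ^ r = - ((- 1) ^ (r - 1))"
      using r by (cases r) simp_all
    moreover have "q_binomial q (n - r + m) r = ?F (n - r + m) / (?F r * ?F (n + m - 2 * r))"
      using q_binomial_eq[OF q1 r(3)] by (simp only: r(4))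
    moreover have "q_super_catalan q (n - r) m =
        ?F (2 * m) / ?F m * (?A (n - r) * ?B (n - r) / ?F (n - r + m))"
      using q_super_catalan_eq[OF q(2), of "n - r" m] by (simp only: add.commute[of m])
    ultimately show ?thesis
      using nz by (simp only:) (simp add: mult_ac)
  qed
  have "K * ?t 0 + (\<Sum>r = 1..?k. K * ?t r) = K * (\<Sum>r\<le>?k. ?t r)"
    by (simp add: distrib_left sum_distrib_left atMost_atLeast0 sum.atLeast_Suc_atMost)
  also have "\<dots> = K * of_bool (m = 0)"
    by (simp only: alternating_q_pochhammer_sum[OF assms])
  \<comment> \<open>For \<open>m = 0\<close> the quotient in \<open>K\<close> is 1.\<close>
  also have "\<dots> = of_bool (m = 0) * ?B n"
    by (simp add: K_def)
  also have "K * ?t 0 = q_super_catalan q n m"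
    using q_super_catalan_eq[OF q(2), of n m] by (simp add: K_def add.commute)
  finally have "q_super_catalan q n m = - (\<Sum>r = 1..?k. K * ?t r) + of_bool (m = 0) * ?B n"
    by (simp add: algebra_simps)
  also have "- (\<Sum>r = 1..?k. K * ?t r) = (\<Sum>r = 1..?k. - (K * ?t r))"
    by (rule sum_negf[symmetric])
  finally show ?thesis
    by (simp only: summand cong: sum.cong)
qed

section \<open>Specialization to the indeterminate\<close>

lemma q_indet_power: "q_indet ^ i = Fract (monom 1 i) 1"
  by (induction i)
    (simp_all add: q_indet_def One_fract_def monom_0 one_pCons monom_Suc)

lemma q_indet_neq_0: "q_indet \<noteq> 0"
  by (simp add: q_indet_def Zero_fract_def eq_fract)

text \<open>The numerators are polynomials of different degrees, \<open>i\<close> and 0.\<close>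

lemma q_indet_power_neq_1:
  assumes "i > 0"
  shows "q_indet ^ i \<noteq> 1"
proof
  assume "q_indet ^ i = 1"
  then have "monom (1::rat) i = 1"
    by (simp add: q_indet_power One_fract_def eq_fract)
  then have "degree (monom (1::rat) i) = 0" by simp
  with assms show False by (simp add: degree_monom_eq)
qed

theorem proposition2:
  fixes n m :: nat and q :: "rat poly fract"
  assumes "q = q_indet" and "m \<le> n"
  shows "(m > 0 \<longrightarrow>
      q_super_catalan q n m =
        (\<Sum>r = 1..(n + m) div 2.
           (- 1) ^ (r - 1) * q powi (int r * (int r - 2 * int m + 1)) *
           q_binomial q (n - r + m) r * q_super_catalan q (n - r) m *
           (q_pochhammer (- (q ^ (n - r + 1))) q r / q_pochhammer (- q) q r))) \<and>
    (m = 0 \<longrightarrow>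
      q_binomial q (2 * n) n =
        (\<Sum>r = 1..n div 2.
           (- 1) ^ (r - 1) * q ^ (r * (r + 1)) *
           q_binomial q (n - r) r * q_binomial q (2 * n - 2 * r) (n - r) *
           (q_pochhammer (- (q ^ (n - r + 1))) q r / q_pochhammer (- q) q r))
        + q_pochhammer (- q) q n)"
proof -
  have q: "q \<noteq> 0" "\<forall>i>0. q ^ i \<noteq> 1"
    using assms(1) q_indet_neq_0 q_indet_power_neq_1 by auto
  note recurrence = q_super_catalan_recurrence[OF q]
  \<comment> \<open>For \<open>m = 0\<close> the exponent is nonnegative, so the integer power
    becomes a natural one.\<close>
  have "q powi (int r * (int r + 1)) = q ^ (r * (r + 1))" for r
    using power_int_of_nat[of q "r * (r + 1)"] by (simp add: algebra_simps)
  then show ?thesis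
    using recurrence[OF \<open>m \<le> n\<close>] recurrence[of 0 n]
    by (simp add: q_super_catalan_0_right diff_mult_distrib2)
qed

end
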